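(* For $\varepsilon > 0$ let $H(\varepsilon) \subset \mathbb{R}^2$ be the union of the closed line segment connecting $(0,0)$ to $(1,\varepsilon)$ and the closed line segment connecting $(1,\varepsilon)$ to $(2,0)$. Let $X = \bigcup_{n \in \mathbb{N},\, n \geq 1} H\left(\frac{1}{n}\right) \subset \mathbb{R}^2$, equipped with the induced path-length metric $d$ (the hat space). Then the metric space $(X,d)$ is bounded, complete and almost convex, but not totally convex.
   Context: The induced path-length metric on a subset $X \subset \mathbb{R}^2$ is defined by letting $d(p,q)$ be the infimum of the Euclidean lengths of the rectifiable continuous paths in $X$ (continuous for the subspace topology from $\mathbb{R}^2$) from $p$ to $q$. A metric space $(X,d)$ is almost convex if, for all $x,y \in X$, all positive real numbers $r,s$ with $r+s = d(x,y)$, and every $\varepsilon > 0$, there is a point $z \in X$ such that $d(x,z) \leq s + \varepsilon$ and $d(y,z) \leq r + \varepsilon$. A metric space $(X,d)$ is totally convex if, for all $x,y \in X$ and all positive real numbers $r,s$ with $r+s = d(x,y)$, there is a point $z \in X$ such that $d(x,z) = s$ and $d(y,z) = r$. *)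

theory Defs
  imports "HOL-Analysis.Analysis"
begin

text \<open>
  The length of a curve is the supremum of the lengths of inscribed polygons, over all
  partitions \<open>0 = t 0 \<le> \<dots> \<le> t n = 1\<close> of the parameter interval; it may be infinite.
\<close>

definition path_length :: "(real \<Rightarrow> 'a::metric_space) \<Rightarrow> ennreal" where
  "path_length g =
     (SUP (n, t) \<in> {(n::nat, t::nat \<Rightarrow> real). t 0 = 0 \<and> t n = 1 \<and> (\<forall>i<n. t i \<le> t (Suc i))}.
        \<Sum>i<n. ennreal (dist (g (t i)) (g (t (Suc i)))))"

definition rectifiable_path :: "(real \<Rightarrow> 'a::metric_space) \<Rightarrow> bool" where
  "rectifiable_path g \<longleftrightarrow> path g \<and> path_length g < \<infinity>"

text \<open>
  The infimum is formed in \<^typ>\<open>ennreal\<close>, so it is \<open>\<infinity>\<close> if no rectifiable path joins the two points,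
  and \<^const>\<open>enn2real\<close> then yields \<open>0\<close>. Hence if this function is a metric on \<open>X\<close> (zero only on
  the diagonal), any two points of \<open>X\<close> are joined by a rectifiable path.
\<close>

definition path_length_dist :: "'a::metric_space set \<Rightarrow> 'a \<Rightarrow> 'a \<Rightarrow> real" where
  "path_length_dist X p q =
     enn2real (INF g \<in> {g. rectifiable_path g \<and> path_image g \<subseteq> X \<and> pathstart g = p \<and> pathfinish g = q}.
       path_length g)"

context Metric_space
begin

definition almost_convex :: bool where
  "almost_convex \<longleftrightarrow>
     (\<forall>x\<in>M. \<forall>y\<in>M. \<forall>r>0. \<forall>s>0. r + s = d x y \<longrightarrow>
        (\<forall>\<epsilon>>0. \<exists>z\<in>M. d x z \<le> s + \<epsilon> \<and> d y z \<le> r + \<epsilon>))"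

definition totally_convex :: bool where
  "totally_convex \<longleftrightarrow>
     (\<forall>x\<in>M. \<forall>y\<in>M. \<forall>r>0. \<forall>s>0. r + s = d x y \<longrightarrow>
        (\<exists>z\<in>M. d x z = s \<and> d y z = r))"

end

text \<open>The plane is \<^typ>\<open>real \<times> real\<close>, whose \<^const>\<open>dist\<close> is the Euclidean distance.\<close>

definition hat :: "real \<Rightarrow> (real \<times> real) set" where
  "hat \<epsilon> = closed_segment (0, 0) (1, \<epsilon>) \<union> closed_segment (1, \<epsilon>) (2, 0)"

definition hat_space :: "(real \<times> real) set" where
  "hat_space = (\<Union>n\<in>{1::nat..}. hat (1 / real n))"

abbreviation hat_dist :: "real \<times> real \<Rightarrow> real \<times> real \<Rightarrow> real" where
  "hat_dist \<equiv> path_length_dist hat_space"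

end

theory Submission
  imports Defs
begin

text \<open>
  Every path-connected length metric is almost convex: cut a nearly shortest path at a suitable
  point. The endpoints \<open>(0, 0)\<close> and \<open>(2, 0)\<close> are at distance \<open>2\<close> as the infimum over ever flatter
  hats, but a midpoint would have to be the Euclidean midpoint \<open>(1, 0)\<close>, which is missing. For
  completeness, two points on different hats are no closer than one of them is to the endpoints, so
  a Cauchy sequence that stays away from the endpoints finally remains in one hat, where the metric
  is bounded by twice the difference of the first coordinates.
\<close>

section \<open>Path length\<close>

lemma partition_bounds:
  fixes t :: "nat \<Rightarrow> real"
  assumes "\<forall>i<n. t i \<le> t (Suc i)" "i \<le> n"
  shows "t 0 \<le> t i" "t i \<le> t n"
proof -
  have "t i \<le> t j" if "i \<le> j" "j \<le> n" for i j
    using that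
  proof (induction rule: dec_induct)
    case (step k)
    then show ?case using assms(1) by (metis Suc_leD Suc_le_lessD order_trans)
  qed simp
  then show "t 0 \<le> t i" "t i \<le> t n" using assms(2) by auto
qed

text \<open>Monotonicity forces all partition points into \<open>{0..1}\<close>, the only interval
  where anything is known about \<open>g\<close>. Upper bounds on lengths therefore get this fact as
  an extra premise.\<close>

lemma path_length_leI:
  assumes "\<And>n t. t 0 = 0 \<Longrightarrow> t n = 1 \<Longrightarrow> (\<And>i. i < n \<Longrightarrow> t i \<le> t (Suc i)) \<Longrightarrow>
    (\<And>i. i \<le> n \<Longrightarrow> t i \<in> {0..1}) \<Longrightarrow>
    (\<Sum>i<n. ennreal (dist (g (t i)) (g (t (Suc i))))) \<le> C"
  shows "path_length g \<le> C"
  unfolding path_length_def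
proof (rule SUP_least, clarify)
  fix n and t :: "nat \<Rightarrow> real"
  assume t: "t 0 = 0" "t n = 1" "\<forall>i<n. t i \<le> t (Suc i)"
  have "t i \<in> {0..1}" if "i \<le> n" for i
    using partition_bounds[OF t(3) that] t by auto
  then show "(\<Sum>i<n. ennreal (dist (g (t i)) (g (t (Suc i))))) \<le> C"
    using assms t by blast
qed

lemma sum_le_path_length:
  assumes "t 0 = 0" "t n = 1" "\<And>i. i < n \<Longrightarrow> t i \<le> t (Suc i)"
  shows "(\<Sum>i<n. ennreal (dist (g (t i)) (g (t (Suc i))))) \<le> path_length g"
  unfolding path_length_def
  by (rule SUP_upper2[of "(n, t)"]) (use assms in auto)

text \<open>The partition \<open>0, s, 1\<close> suffices. An intermediate \<open>s\<close> is
  allowed because a path between different hats is measured only up to a parameter where it meets an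
  endpoint.\<close>

lemma dist_start_le_path_length:
  assumes "s \<in> {0..1}"
  shows "ennreal (dist (g 0) (g s)) \<le> path_length g"
proof -
  define t :: "nat \<Rightarrow> real" where "t i = (if i = 0 then 0 else if i = 1 then s else 1)" for i
  have "(\<Sum>i<2. ennreal (dist (g (t i)) (g (t (Suc i))))) \<le> path_length g"
    by (rule sum_le_path_length) (use assms in \<open>auto simp: t_def\<close>)
  moreover have "ennreal (dist (g 0) (g s)) \<le> (\<Sum>i<2. ennreal (dist (g (t i)) (g (t (Suc i)))))"
    by (simp add: t_def numeral_2_eq_2)
  ultimately show ?thesis by (rule order_trans[rotated])
qed

lemma dist_endpoints_le_path_length:
  "ennreal (dist (pathstart g) (pathfinish g)) \<le> path_length g"
  using dist_start_le_path_length[of 1 g] by (simp add: pathstart_def pathfinish_def)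

text \<open>The estimates of the single edges telescope. This bounds the length of constant paths as
  well as of paths along one hat.\<close>

lemma path_length_lipschitz:
  assumes "C \<ge> 0" "\<And>s t. \<lbrakk>0 \<le> s; s \<le> t; t \<le> 1\<rbrakk> \<Longrightarrow> dist (g s) (g t) \<le> C * (t - s)"
  shows "path_length g \<le> ennreal C"
proof (rule path_length_leI)
  fix n and t :: "nat \<Rightarrow> real"
  assume t: "t 0 = 0" "t n = 1" "\<And>i. i < n \<Longrightarrow> t i \<le> t (Suc i)" "\<And>i. i \<le> n \<Longrightarrow> t i \<in> {0..1}"
  have "dist (g (t i)) (g (t (Suc i))) \<le> C * (t (Suc i) - t i)" if "i < n" for i
    using assms(2)[of "t i" "t (Suc i)"] t(3)[of i] t(4)[of i] t(4)[of "Suc i"] that by auto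
  then have "(\<Sum>i<n. dist (g (t i)) (g (t (Suc i)))) \<le> (\<Sum>i<n. C * (t (Suc i) - t i))"
    by (intro sum_mono) auto
  also have "\<dots> = C"
    by (simp add: sum_distrib_left[symmetric] sum_lessThan_telescope t)
  finally show "(\<Sum>i<n. ennreal (dist (g (t i)) (g (t (Suc i))))) \<le> ennreal C"
    by (simp add: ennreal_leI)
qed

section \<open>Length under reversal, concatenation and subdivision\<close>

lemma path_length_reversepath: "path_length (reversepath g) \<le> path_length g"
proof (rule path_length_leI)
  fix n and t :: "nat \<Rightarrow> real"
  assume t: "t 0 = 0" "t n = 1" "\<And>i. i < n \<Longrightarrow> t i \<le> t (Suc i)" "\<And>i. i \<le> n \<Longrightarrow> t i \<in> {0..1}"
  \<comment> \<open>Reflecting both the parameter and the index turns the partition of the reversed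
    path into a partition of \<open>g\<close> with the same edges.\<close>
  define t' where "t' i = 1 - t (n - i)" for i
  have "(\<Sum>i<n. ennreal (dist (reversepath g (t i)) (reversepath g (t (Suc i)))))
    = (\<Sum>i<n. ennreal (dist (reversepath g (t (n - Suc i))) (reversepath g (t (Suc (n - Suc i))))))"
    by (rule sum.nat_diff_reindex[symmetric])
  also have "\<dots> = (\<Sum>i<n. ennreal (dist (g (t' i)) (g (t' (Suc i)))))"
    by (rule sum.cong) (auto simp: t'_def reversepath_def dist_commute Suc_diff_Suc)
  also have "\<dots> \<le> path_length g"
  proof (rule sum_le_path_length)
    show "t' i \<le> t' (Suc i)" if "i < n" for i
      using t(3)[of "n - Suc i"] that by (simp add: t'_def Suc_diff_Suc)
  qed (simp_all add: t'_def t)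
  finally show "(\<Sum>i<n. ennreal (dist (reversepath g (t i)) (reversepath g (t (Suc i))))) \<le> path_length g" .
qed

text \<open>Clamping a partition of the joined path to each half yields partitions of both pieces, so no
  partition point needs to be inserted at the junction.\<close>

lemma path_length_joinpaths:
  assumes "pathfinish g = pathstart h"
  shows "path_length (g +++ h) \<le> path_length g + path_length h"
proof (rule path_length_leI)
  fix n and t :: "nat \<Rightarrow> real"
  assume t: "t 0 = 0" "t n = 1" "\<And>i. i < n \<Longrightarrow> t i \<le> t (Suc i)" "\<And>i. i \<le> n \<Longrightarrow> t i \<in> {0..1}"
  define a where "a i = min 1 (2 * t i)" for i
  define b where "b i = max 0 (2 * t i - 1)" for i
  have gh: "g 1 = h 0" using assms by (simp add: pathstart_def pathfinish_def)
  have "dist ((g +++ h) (t i)) ((g +++ h) (t (Suc i)))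
      \<le> dist (g (a i)) (g (a (Suc i))) + dist (h (b i)) (h (b (Suc i)))" if "i < n" for i
  proof -
    consider "t (Suc i) \<le> 1/2" | "t i > 1/2" | "t i \<le> 1/2" "t (Suc i) > 1/2" by linarith
    then show ?thesis
    proof cases
      \<comment> \<open>Only an edge that straddles the junction needs the triangle inequality,
        through the common point \<open>h 0\<close>. In the other cases one of the two summands
        vanishes.\<close>
      case 3
      then have "a i = 2 * t i" "a (Suc i) = 1" "b i = 0" "b (Suc i) = 2 * t (Suc i) - 1"
        by (auto simp: a_def b_def)
      then show ?thesis
        using 3 dist_triangle[of "g (2 * t i)" "h (2 * t (Suc i) - 1)" "h 0"]
        by (simp add: joinpaths_def gh)
    next
      case 1
      then have "a i = 2 * t i" "a (Suc i) = 2 * t (Suc i)" "b i = 0" "b (Suc i) = 0" "t i \<le> 1/2"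
        using t(3)[OF that] by (auto simp: a_def b_def)
      with 1 show ?thesis by (simp add: joinpaths_def)
    next
      case 2
      then have "a i = 1" "a (Suc i) = 1" "b i = 2 * t i - 1" "b (Suc i) = 2 * t (Suc i) - 1"
          "t (Suc i) > 1/2"
        using t(3)[OF that] by (auto simp: a_def b_def)
      with 2 show ?thesis by (simp add: joinpaths_def)
    qed
  qed
  then have "(\<Sum>i<n. ennreal (dist ((g +++ h) (t i)) ((g +++ h) (t (Suc i)))))
    \<le> (\<Sum>i<n. ennreal (dist (g (a i)) (g (a (Suc i)))) + ennreal (dist (h (b i)) (h (b (Suc i)))))"
    by (intro sum_mono) (auto simp flip: ennreal_plus intro!: ennreal_leI)
  also have "\<dots> = (\<Sum>i<n. ennreal (dist (g (a i)) (g (a (Suc i)))))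
      + (\<Sum>i<n. ennreal (dist (h (b i)) (h (b (Suc i)))))"
    by (rule sum.distrib)
  also have "\<dots> \<le> path_length g + path_length h"
  proof (intro add_mono sum_le_path_length)
    show "a i \<le> a (Suc i)" "b i \<le> b (Suc i)" if "i < n" for i
      using t(3)[OF that] by (auto simp: a_def b_def)
  qed (simp_all add: a_def b_def t)
  finally show "(\<Sum>i<n. ennreal (dist ((g +++ h) (t i)) ((g +++ h) (t (Suc i)))))
    \<le> path_length g + path_length h" .
qed

lemma sum_lessThan_add:
  fixes f :: "nat \<Rightarrow> 'a::comm_monoid_add"
  shows "(\<Sum>i<m + n. f i) = (\<Sum>i<m. f i) + (\<Sum>i<n. f (m + i))"
  by (induction n) (auto simp: add.assoc)

text \<open>Partitions of the two pieces, rescaled and put one after the other, form a partition of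
  the whole path that contains \<open>u\<close>. The two suprema are then taken
  independently.\<close>

lemma path_length_subpaths_add_le:
  assumes "u \<in> {0..1}"
  shows "path_length (subpath 0 u g) + path_length (subpath u 1 g) \<le> path_length g"
proof -
  define S where "S = {(n::nat, t::nat \<Rightarrow> real). t 0 = 0 \<and> t n = 1 \<and> (\<forall>i<n. t i \<le> t (Suc i))}"
  define P where "P h = (\<lambda>(n::nat, t::nat \<Rightarrow> real). \<Sum>i<n. ennreal (dist (h (t i)) (h (t (Suc i)))))"
    for h :: "real \<Rightarrow> 'a"
  have pl: "path_length h = (SUP p\<in>S. P h p)" for h :: "real \<Rightarrow> 'a"
    by (simp add: path_length_def S_def P_def)
  have "(1, real) \<in> S" by (simp add: S_def)
  \<comment> \<open>In \<open>ennreal\<close> the empty supremum is \<open>0\<close>, so a constant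
    summand moves into a supremum only over a nonempty index set.\<close>
  then have S: "S \<noteq> {}" by blast
  have *: "P (subpath 0 u g) p + P (subpath u 1 g) q \<le> path_length g" if "p \<in> S" "q \<in> S" for p q
  proof -
    obtain m a n b where p: "p = (m, a)" and q: "q = (n, b)" by (metis prod.exhaust)
    have a: "a 0 = 0" "a m = 1" "\<forall>i<m. a i \<le> a (Suc i)"
      and b: "b 0 = 0" "b n = 1" "\<forall>i<n. b i \<le> b (Suc i)"
      using that by (auto simp: p q S_def)
    define t where "t i = (if i \<le> m then u * a i else (1 - u) * b (i - m) + u)" for i
    \<comment> \<open>The second formula is valid at the junction \<open>i = 0\<close> too, since
      both branches give \<open>u\<close> there.\<close>
    have t2: "t (m + i) = (1 - u) * b i + u" for i
      by (cases i) (auto simp: t_def a b)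
    have "P (subpath 0 u g) p + P (subpath u 1 g) q
      = (\<Sum>i<m + n. ennreal (dist (g (t i)) (g (t (Suc i)))))"
      unfolding sum_lessThan_add add_Suc_right[symmetric] t2
      by (simp add: P_def p q subpath_def t_def)
    also have "\<dots> \<le> path_length g"
    proof (rule sum_le_path_length)
      show "t 0 = 0" by (simp add: t_def a)
      show "t (m + n) = 1" by (simp add: t2 b)
      fix i assume i: "i < m + n"
      show "t i \<le> t (Suc i)"
      proof (cases "i < m")
        case True
        then show ?thesis using a assms by (auto simp: t_def intro!: mult_left_mono)
      next
        case False
        then obtain j where j: "i = m + j" by (metis le_add_diff_inverse not_less)
        have "t (m + j) \<le> t (m + Suc j)"
          unfolding t2 using b assms i j by (auto intro!: mult_left_mono)
        then show ?thesis by (simp add: j)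
      qed
    qed
    finally show ?thesis .
  qed
  have "path_length (subpath 0 u g) + path_length (subpath u 1 g)
    = (SUP p\<in>S. P (subpath 0 u g) p + path_length (subpath u 1 g))"
    unfolding pl[of "subpath 0 u g"] by (rule ennreal_SUP_add_left[OF S, symmetric])
  also have "\<dots> = (SUP p\<in>S. SUP q\<in>S. P (subpath 0 u g) p + P (subpath u 1 g) q)"
    unfolding pl by (simp only: ennreal_SUP_add_right[OF S])
  also have "\<dots> \<le> path_length g"
    by (intro SUP_least *)
  finally show ?thesis .
qed

text \<open>Lower semicontinuity of length: for a fixed partition the length of the inscribed
  polygon depends continuously on the ends of the subpath, so the bound passes to the limit. A
  general filter covers both sequences and one-sided limits.\<close>

lemma path_length_subpath_tendsto_le:
  assumes g: "path g" and uv: "(u \<longlongrightarrow> a) F" "(v \<longlongrightarrow> b) F" and F: "F \<noteq> bot"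
    and ab: "a \<in> {0..1}" "b \<in> {0..1}"
    and ev: "\<forall>\<^sub>F x in F. u x \<in> {0..1} \<and> v x \<in> {0..1} \<and> path_length (subpath (u x) (v x) g) \<le> C"
  shows "path_length (subpath a b g) \<le> C"
proof (rule path_length_leI)
  fix n and t :: "nat \<Rightarrow> real"
  assume t: "t 0 = 0" "t n = 1" "\<And>i. i < n \<Longrightarrow> t i \<le> t (Suc i)" "\<And>i. i \<le> n \<Longrightarrow> t i \<in> {0..1}"
  \<comment> \<open>\<open>subpath\<close> evaluates \<open>g\<close> at this convex combination of
    \<open>a\<close> and \<open>b\<close>, and \<open>g\<close> is known to be continuous only on
    \<open>{0..1}\<close>.\<close>
  have conv: "(b - a) * x + a \<in> {0..1}" if "a \<in> {0..1}" "b \<in> {0..1}" "x \<in> {0..1}" for a b x :: real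
  proof -
    have "(b - a) * x + a = (1 - x) * a + x * b" by (simp add: algebra_simps)
    moreover have "0 \<le> (1 - x) * a + x * b" using that by (auto intro!: add_nonneg_nonneg)
    moreover have "(1 - x) * a + x * b \<le> 1" using convex_bound_le[of a 1 b "1 - x" x] that by auto
    ultimately show ?thesis by simp
  qed
  have lim: "((\<lambda>x. subpath (u x) (v x) g (t i)) \<longlongrightarrow> subpath a b g (t i)) F" if "i \<le> n" for i
    unfolding subpath_def
  proof (rule continuous_on_tendsto_compose[OF g[unfolded path_def]])
    show "((\<lambda>x. (v x - u x) * t i + u x) \<longlongrightarrow> (b - a) * t i + a) F"
      by (intro tendsto_intros uv)
    show "\<forall>\<^sub>F x in F. (v x - u x) * t i + u x \<in> {0..1}"
      using ev by eventually_elim (use conv t(4)[OF that] in blast)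
  qed (use conv ab t(4)[OF that] in blast)
  have "((\<lambda>x. \<Sum>i<n. ennreal (dist (subpath (u x) (v x) g (t i)) (subpath (u x) (v x) g (t (Suc i)))))
    \<longlongrightarrow> (\<Sum>i<n. ennreal (dist (subpath a b g (t i)) (subpath a b g (t (Suc i)))))) F"
    by (intro tendsto_sum tendsto_ennrealI tendsto_dist lim) auto
  then show "(\<Sum>i<n. ennreal (dist (subpath a b g (t i)) (subpath a b g (t (Suc i))))) \<le> C"
  proof (rule tendsto_upperbound[OF _ _ F])
    show "\<forall>\<^sub>F x in F. (\<Sum>i<n. ennreal (dist (subpath (u x) (v x) g (t i)) (subpath (u x) (v x) g (t (Suc i))))) \<le> C"
      using ev by eventually_elim (use t in \<open>blast intro: sum_le_path_length order_trans\<close>)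
  qed
qed

section \<open>The induced path-length metric\<close>

text \<open>This rules out the default value \<open>0\<close> of \<open>path_length_dist\<close> at
  pairs that no rectifiable path joins, so that lower bounds on all paths become lower bounds on the
  distance.\<close>

definition rectifiably_connected :: "'a::metric_space set \<Rightarrow> bool" where
  "rectifiably_connected X \<longleftrightarrow> (\<forall>p\<in>X. \<forall>q\<in>X.
     \<exists>g. rectifiable_path g \<and> path_image g \<subseteq> X \<and> pathstart g = p \<and> pathfinish g = q)"

lemma path_length_dist_le:
  assumes "path g" "path_image g \<subseteq> X" "path_length g \<le> ennreal c" "c \<ge> 0"
  shows "path_length_dist X (pathstart g) (pathfinish g) \<le> c"
proof -
  have "path_length g < \<infinity>" using assms(3) by (simp add: order.strict_trans1)
  then have "(INF h \<in> {h. rectifiable_path h \<and> path_image h \<subseteq> X \<and> pathstart h = pathstart g \<and> pathfinish h = pathfinish g}.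
       path_length h) \<le> path_length g"
    using assms by (intro INF_lower) (auto simp: rectifiable_path_def)
  with assms(3) have "(INF h \<in> {h. rectifiable_path h \<and> path_image h \<subseteq> X \<and> pathstart h = pathstart g \<and> pathfinish h = pathfinish g}.
       path_length h) \<le> ennreal c" by (rule order_trans[rotated])
  then show ?thesis
    unfolding path_length_dist_def using assms(4) by (intro enn2real_leI)
qed

lemma path_length_dist_lessE:
  assumes "rectifiably_connected X" "p \<in> X" "q \<in> X" "path_length_dist X p q < c"
  obtains g where "path g" "path_image g \<subseteq> X" "pathstart g = p" "pathfinish g = q"
    "path_length g < ennreal c"
proof -
  define G where "G = {g. rectifiable_path g \<and> path_image g \<subseteq> X \<and> pathstart g = p \<and> pathfinish g = q}"
  obtain h where h: "h \<in> G" using assms(1-3) unfolding rectifiably_connected_def G_def by blast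
  \<comment> \<open>One rectifiable path makes the infimum finite, and only then does
    \<open>ennreal\<close> undo \<open>enn2real\<close>.\<close>
  have "(INF g\<in>G. path_length g) \<le> path_length h" using h by (rule INF_lower)
  also have "\<dots> < top" using h by (simp add: G_def rectifiable_path_def)
  finally have "(INF g\<in>G. path_length g) = ennreal (path_length_dist X p q)"
    by (simp add: path_length_dist_def G_def)
  also have "\<dots> < ennreal c"
    using assms(4) by (subst ennreal_less_iff) (auto simp: path_length_dist_def)
  finally obtain g where "g \<in> G" "path_length g < ennreal c"
    by (auto simp: INF_less_iff)
  then show ?thesis using that by (auto simp: G_def rectifiable_path_def)
qed

lemma path_length_dist_geI:
  assumes X: "rectifiably_connected X" "p \<in> X" "q \<in> X"
    and "\<And>g. \<lbrakk>path g; path_image g \<subseteq> X; pathstart g = p; pathfinish g = q\<rbrakk> \<Longrightarrow> ennreal c \<le> path_length g"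
  shows "c \<le> path_length_dist X p q"
proof (rule ccontr)
  assume "\<not> ?thesis"
  then obtain g where "path g" "path_image g \<subseteq> X" "pathstart g = p" "pathfinish g = q"
    "path_length g < ennreal c"
    using path_length_dist_lessE[OF X, of c] by (auto simp: not_le)
  then show False using assms(4)[of g] by (simp add: not_le)
qed

lemma path_length_dist_nonneg: "0 \<le> path_length_dist X p q"
  by (simp add: path_length_dist_def)

lemma dist_le_path_length_dist:
  assumes "rectifiably_connected X" "p \<in> X" "q \<in> X"
  shows "dist p q \<le> path_length_dist X p q"
  by (rule path_length_dist_geI[OF assms]) (use dist_endpoints_le_path_length in auto)

lemma path_length_dist_commute: "path_length_dist X p q = path_length_dist X q p"
proof -
  have "(INF g \<in> {g. rectifiable_path g \<and> path_image g \<subseteq> X \<and> pathstart g = p \<and> pathfinish g = q}. path_length g)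
    \<le> (INF g \<in> {g. rectifiable_path g \<and> path_image g \<subseteq> X \<and> pathstart g = q \<and> pathfinish g = p}. path_length g)"
    for p q :: 'a
  proof (rule INF_mono)
    fix g assume g: "g \<in> {g. rectifiable_path g \<and> path_image g \<subseteq> X \<and> pathstart g = q \<and> pathfinish g = p}"
    have "path_length (reversepath g) \<le> path_length g" by (rule path_length_reversepath)
    with g show "\<exists>h\<in>{g. rectifiable_path g \<and> path_image g \<subseteq> X \<and> pathstart g = p \<and> pathfinish g = q}.
        path_length h \<le> path_length g"
      by (intro bexI[of _ "reversepath g"]) (auto simp: rectifiable_path_def)
  qed
  then show ?thesis unfolding path_length_dist_def by (intro arg_cong[of _ _ enn2real] antisym)
qed

section \<open>Metric axioms and almost convexity\<close>

lemma Metric_space_path_length_dist: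
  assumes X: "rectifiably_connected X"
  shows "Metric_space X (path_length_dist X)"
proof
  show "0 \<le> path_length_dist X p q" for p q by (rule path_length_dist_nonneg)
  show "path_length_dist X p q = path_length_dist X q p" for p q by (rule path_length_dist_commute)
  have refl: "path_length_dist X p p = 0" if "p \<in> X" for p
    using path_length_dist_le[of "\<lambda>_. p" X 0] path_length_lipschitz[of 0 "\<lambda>_. p"] that
      path_length_dist_nonneg[of X p p]
    by (auto simp: path_def path_image_def pathstart_def pathfinish_def image_subset_iff)
  show "path_length_dist X p q = 0 \<longleftrightarrow> p = q" if "p \<in> X" "q \<in> X" for p q
    using dist_le_path_length_dist[OF X that] refl that by auto
  show "path_length_dist X p r \<le> path_length_dist X p q + path_length_dist X q r"
    if "p \<in> X" "q \<in> X" "r \<in> X" for p q r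
  \<comment> \<open>The infima need not be attained, so nearly shortest paths with excess
    \<open>e / 2\<close> each are joined.\<close>
  proof (rule field_le_epsilon)
    fix e :: real assume "e > 0"
    obtain g where g: "path g" "path_image g \<subseteq> X" "pathstart g = p" "pathfinish g = q"
        "path_length g < ennreal (path_length_dist X p q + e / 2)"
      using path_length_dist_lessE[OF X \<open>p \<in> X\<close> \<open>q \<in> X\<close>, of "path_length_dist X p q + e / 2"] \<open>e > 0\<close>
      by auto
    obtain h where h: "path h" "path_image h \<subseteq> X" "pathstart h = q" "pathfinish h = r"
        "path_length h < ennreal (path_length_dist X q r + e / 2)"
      using path_length_dist_lessE[OF X \<open>q \<in> X\<close> \<open>r \<in> X\<close>, of "path_length_dist X q r + e / 2"] \<open>e > 0\<close>
      by auto
    have "path_length (g +++ h) \<le> path_length g + path_length h"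
      using g h by (intro path_length_joinpaths) auto
    also have "\<dots> \<le> ennreal (path_length_dist X p q + e / 2) + ennreal (path_length_dist X q r + e / 2)"
      using g h by (intro add_mono) auto
    also have "\<dots> = ennreal (path_length_dist X p q + path_length_dist X q r + e)"
      using \<open>e > 0\<close> by (simp add: path_length_dist_nonneg algebra_simps flip: ennreal_plus)
    finally have "path_length_dist X (pathstart (g +++ h)) (pathfinish (g +++ h))
        \<le> path_length_dist X p q + path_length_dist X q r + e"
      using g h \<open>e > 0\<close>
      by (intro path_length_dist_le) (auto simp: path_length_dist_nonneg path_image_join)
    then show "path_length_dist X p r \<le> path_length_dist X p q + path_length_dist X q r + e"
      using g h by simp
  qed
qed

text \<open>On a path of length below \<open>d x y + \<epsilon>\<close>, cut at the last parameter up to which the length is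
  at most \<open>s\<close>.\<close>

lemma almost_convex_path_length_dist:
  fixes X :: "'a::real_normed_vector set"
  assumes X: "rectifiably_connected X"
  shows "Metric_space.almost_convex X (path_length_dist X)"
  unfolding Metric_space.almost_convex_def[OF Metric_space_path_length_dist[OF X]]
proof (intro ballI allI impI)
  fix x y and r s \<epsilon> :: real
  assume xy: "x \<in> X" "y \<in> X" and rs: "0 < r" "0 < s" "r + s = path_length_dist X x y" and "0 < \<epsilon>"
  have "path_length_dist X x y < r + s + \<epsilon>" using rs \<open>0 < \<epsilon>\<close> by linarith
  then obtain g where g: "path g" "path_image g \<subseteq> X" "pathstart g = x" "pathfinish g = y"
      "path_length g < ennreal (r + s + \<epsilon>)"
    by (rule path_length_dist_lessE[OF X xy])
  define T where "T = {t \<in> {0..1}. path_length (subpath 0 t g) \<le> ennreal s}"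
  define u where "u = Sup T"
  have "0 \<in> T"
    using path_length_lipschitz[of s "subpath 0 0 g"] rs by (auto simp: T_def subpath_def)
  have bdd: "bdd_above T" by (rule bdd_aboveI[of _ 1]) (auto simp: T_def)
  have "0 \<le> u" unfolding u_def using \<open>0 \<in> T\<close> bdd by (rule cSup_upper)
  moreover have "u \<le> 1" unfolding u_def using \<open>0 \<in> T\<close>
    by (intro cSup_least) (blast, simp add: T_def)
  ultimately have u: "u \<in> {0..1}" by simp
  \<comment> \<open>The supremum is a limit of points of \<open>T\<close>, and semicontinuity keeps
    the bound in the limit.\<close>
  have first: "path_length (subpath 0 u g) \<le> ennreal s"
  proof -
    have "u \<in> closure T"
      unfolding u_def using \<open>0 \<in> T\<close> bdd by (intro closure_contains_Sup) auto
    then obtain f where f: "\<And>n. f n \<in> T" "f \<longlonglongrightarrow> u" by (auto simp: closure_sequential)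
    show ?thesis
      by (rule path_length_subpath_tendsto_le[OF g(1) tendsto_const f(2)])
        (use u f(1) in \<open>auto simp: T_def\<close>)
  qed
  \<comment> \<open>The whole excess \<open>\<epsilon>\<close> is charged to the second piece. The
    case \<open>u = 1\<close> is separate because no parameter lies to its right.\<close>
  have second: "path_length (subpath u 1 g) \<le> ennreal (r + \<epsilon>)"
  proof (cases "u = 1")
    case True
    then show ?thesis
      using path_length_lipschitz[of "r + \<epsilon>" "subpath u 1 g"] rs \<open>0 < \<epsilon>\<close> by (auto simp: subpath_def)
  next
    case False
    have *: "path_length (subpath t 1 g) \<le> ennreal (r + \<epsilon>)" if t: "t \<in> {u<..<1}" for t
    proof -
      \<comment> \<open>Beyond \<open>u\<close> the initial piece is longer than \<open>s\<close>,
        so superadditivity leaves at most \<open>r + \<epsilon>\<close> for the rest.\<close>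
      have "t \<notin> T" using cSup_upper[OF _ bdd, of t] t by (auto simp: u_def)
      then have "ennreal s \<le> path_length (subpath 0 t g)" using t u by (auto simp: T_def)
      then have "ennreal s + path_length (subpath t 1 g)
          \<le> path_length (subpath 0 t g) + path_length (subpath t 1 g)" by (rule add_right_mono)
      also have "\<dots> \<le> path_length g" using t u by (intro path_length_subpaths_add_le) auto
      also have "\<dots> \<le> ennreal s + ennreal (r + \<epsilon>)"
        using g(5) rs \<open>0 < \<epsilon>\<close> by (simp add: algebra_simps flip: ennreal_plus)
      finally show ?thesis by simp
    qed
    \<comment> \<open>The bound is known only strictly to the right of \<open>u\<close>; letting
      \<open>t\<close> decrease to \<open>u\<close> extends it to \<open>u\<close> itself.\<close>
    have "\<forall>\<^sub>F t in at_right u. t \<in> {u<..<1}"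
      using u False by (intro eventually_at_right_real) auto
    then show ?thesis
      by (intro path_length_subpath_tendsto_le[OF g(1) tendsto_ident_at tendsto_const])
        (use u * in \<open>auto elim!: eventually_mono\<close>)
  qed
  have sub: "path (subpath 0 u g)" "path_image (subpath 0 u g) \<subseteq> X"
    "path (subpath u 1 g)" "path_image (subpath u 1 g) \<subseteq> X"
    using u g path_image_subpath_subset[of 0 u g] path_image_subpath_subset[of u 1 g] by auto
  show "\<exists>z\<in>X. path_length_dist X x z \<le> s + \<epsilon> \<and> path_length_dist X y z \<le> r + \<epsilon>"
  proof (intro bexI conjI)
    show "g u \<in> X" using u g(2) by (auto simp: path_image_def)
    show "path_length_dist X x (g u) \<le> s + \<epsilon>"
      using path_length_dist_le[OF sub(1,2) first] rs \<open>0 < \<epsilon>\<close> g(3)[unfolded pathstart_def] by simp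
    show "path_length_dist X y (g u) \<le> r + \<epsilon>"
      using path_length_dist_le[OF sub(3,4) second] rs \<open>0 < \<epsilon>\<close> g(4)[unfolded pathfinish_def]
      by (simp add: path_length_dist_commute[of X y])
  qed
qed

section \<open>The hat space\<close>

text \<open>Each hat is a graph over \<open>{0..2}\<close>, so the first coordinate can serve as
  parameter from here on.\<close>

lemma hat_eq: "hat \<epsilon> = (\<lambda>x. (x, \<epsilon> * (1 - \<bar>x - 1\<bar>))) ` {0..2}"
proof (intro equalityI subsetI)
  fix p assume "p \<in> hat \<epsilon>"
  then consider u where "u \<in> {0..1}" "p = (u, u * \<epsilon>)"
    | u where "u \<in> {0..1}" "p = (1 + u, (1 - u) * \<epsilon>)"
    by (fastforce simp: hat_def in_segment algebra_simps)
  then show "p \<in> (\<lambda>x. (x, \<epsilon> * (1 - \<bar>x - 1\<bar>))) ` {0..2}"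
  proof cases
    case (1 u)
    then show ?thesis by (intro image_eqI[of _ _ u]) auto
  next
    case (2 u)
    then show ?thesis by (intro image_eqI[of _ _ "1 + u"]) auto
  qed
next
  fix p assume "p \<in> (\<lambda>x. (x, \<epsilon> * (1 - \<bar>x - 1\<bar>))) ` {0..2}"
  then obtain x where x: "0 \<le> x" "x \<le> 2" "p = (x, \<epsilon> * (1 - \<bar>x - 1\<bar>))" by auto
  show "p \<in> hat \<epsilon>"
  proof (cases "x \<le> 1")
    case True
    then have "p \<in> closed_segment (0, 0) (1, \<epsilon>)"
      unfolding in_segment using x by (intro exI[of _ x]) auto
    then show ?thesis by (simp add: hat_def)
  next
    case False
    then have "p \<in> closed_segment (1, \<epsilon>) (2, 0)"
      unfolding in_segment using x by (intro exI[of _ "x - 1"]) (auto simp: algebra_simps)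
    then show ?thesis by (simp add: hat_def)
  qed
qed

text \<open>For \<open>x\<close> in \<open>{0..2}\<close> this parametrizes
  \<open>hat (1 / real n)\<close>. At \<open>0\<close> and \<open>2\<close> the value is independent
  of \<open>n\<close>: there the hats are glued together.\<close>

definition hat_point :: "nat \<Rightarrow> real \<Rightarrow> real \<times> real" where
  "hat_point n x = (x, (1 - \<bar>x - 1\<bar>) / real n)"

lemma fst_hat_point [simp]: "fst (hat_point n x) = x"
  by (simp add: hat_point_def)

lemma hat_space_eq: "hat_space = {hat_point n x | n x. n \<ge> 1 \<and> x \<in> {0..2}}"
  by (auto simp: hat_space_def hat_eq hat_point_def)

lemma hat_spaceE:
  assumes "p \<in> hat_space"
  obtains n x where "n \<ge> 1" "0 \<le> x" "x \<le> 2" "p = hat_point n x"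
  using assms by (auto simp: hat_space_eq)

lemma hat_point_in_hat_space: "\<lbrakk>n \<ge> 1; 0 \<le> x; x \<le> 2\<rbrakk> \<Longrightarrow> hat_point n x \<in> hat_space"
  by (auto simp: hat_space_eq)

lemma hat_point_0: "hat_point n 0 = (0, 0)" and hat_point_2: "hat_point n 2 = (2, 0)"
  by (auto simp: hat_point_def)

text \<open>The Euclidean norm is bounded by the sum of the coordinate differences. Though crude,
  the factor tends to \<open>1\<close> as the hats flatten, which is enough for the distance of the
  endpoints.\<close>

lemma dist_hat_point_le: "dist (hat_point n x) (hat_point n y) \<le> (1 + 1 / real n) * \<bar>x - y\<bar>"
proof -
  have "dist (hat_point n x) (hat_point n y) \<le> \<bar>x - y\<bar> + \<bar>(1 - \<bar>x - 1\<bar>) / real n - (1 - \<bar>y - 1\<bar>) / real n\<bar>"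
    unfolding hat_point_def dist_Pair_Pair dist_real_def
    using sqrt_sum_squares_le_sum_abs by fastforce
  also have "\<bar>(1 - \<bar>x - 1\<bar>) / real n - (1 - \<bar>y - 1\<bar>) / real n\<bar> = \<bar>\<bar>y - 1\<bar> - \<bar>x - 1\<bar>\<bar> / real n"
    by (simp flip: diff_divide_distrib)
  also have "\<dots> \<le> \<bar>x - y\<bar> / real n"
    by (intro divide_right_mono) auto
  finally show ?thesis by (simp add: algebra_simps)
qed

lemma hat_path:
  assumes n: "n \<ge> 1" and xy: "x \<in> {0..2}" "y \<in> {0..2}"
  obtains g where "path g" "path_image g \<subseteq> hat_space" "pathstart g = hat_point n x"
    "pathfinish g = hat_point n y" "path_length g \<le> ennreal ((1 + 1 / real n) * \<bar>x - y\<bar>)"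
proof
  define g where "g = hat_point n \<circ> linepath x y"
  have "linepath x y ` {0..1} \<subseteq> {0..2}"
    using xy unfolding path_image_def[symmetric] path_image_linepath closed_segment_eq_real_ivl by auto
  then show "path_image g \<subseteq> hat_space"
    using n by (auto simp: path_image_def g_def image_subset_iff intro!: hat_point_in_hat_space)
  show "path g"
    unfolding path_def g_def comp_def hat_point_def linepath_def using n by (intro continuous_intros) auto
  show "pathstart g = hat_point n x" "pathfinish g = hat_point n y"
    by (simp_all add: g_def pathstart_def pathfinish_def linepath_def)
  show "path_length g \<le> ennreal ((1 + 1 / real n) * \<bar>x - y\<bar>)"
  proof (rule path_length_lipschitz)
    fix s t :: real assume st: "0 \<le> s" "s \<le> t" "t \<le> 1"
    have "linepath x y s - linepath x y t = (t - s) * (x - y)"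
      by (simp add: linepath_def algebra_simps)
    then have "\<bar>linepath x y s - linepath x y t\<bar> = \<bar>x - y\<bar> * (t - s)"
      using st by (simp add: abs_mult)
    then show "dist (g s) (g t) \<le> (1 + 1 / real n) * \<bar>x - y\<bar> * (t - s)"
      using dist_hat_point_le[of n "linepath x y s" "linepath x y t"] by (simp add: g_def)
  qed simp
qed

text \<open>Each point is joined to \<open>(0, 0)\<close>, which lies on all hats, along its own
  hat.\<close>

lemma rectifiably_connected_hat_space: "rectifiably_connected hat_space"
  unfolding rectifiably_connected_def
proof (intro ballI)
  fix p q assume "p \<in> hat_space" "q \<in> hat_space"
  then obtain n x m y where p: "n \<ge> 1" "0 \<le> x" "x \<le> 2" "p = hat_point n x"
    and q: "m \<ge> 1" "0 \<le> y" "y \<le> 2" "q = hat_point m y"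
    by (auto elim!: hat_spaceE)
  obtain g where g: "path g" "path_image g \<subseteq> hat_space" "pathstart g = p" "pathfinish g = (0, 0)"
      "path_length g \<le> ennreal ((1 + 1 / real n) * \<bar>x - 0\<bar>)"
    using p by (auto intro: hat_path[of n x 0] simp: hat_point_0)
  obtain h where h: "path h" "path_image h \<subseteq> hat_space" "pathstart h = (0, 0)" "pathfinish h = q"
      "path_length h \<le> ennreal ((1 + 1 / real m) * \<bar>0 - y\<bar>)"
    using q by (auto intro: hat_path[of m 0 y] simp: hat_point_0)
  have "path_length (g +++ h) \<le> path_length g + path_length h"
    using g h by (intro path_length_joinpaths) auto
  also have "\<dots> < \<infinity>"
    using g(5) h(5) by (simp add: order.strict_trans1)
  finally show "\<exists>g. rectifiable_path g \<and> path_image g \<subseteq> hat_space \<and> pathstart g = p \<and> pathfinish g = q"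
    using g h by (intro exI[of _ "g +++ h"]) (auto simp: rectifiable_path_def path_image_join)
qed

section \<open>Distances within one hat and between different hats\<close>

lemma hat_dist_same_hat:
  assumes "n \<ge> 1" "x \<in> {0..2}" "y \<in> {0..2}"
  shows "hat_dist (hat_point n x) (hat_point n y) \<le> (1 + 1 / real n) * \<bar>x - y\<bar>"
proof -
  obtain g where g: "path g" "path_image g \<subseteq> hat_space" "pathstart g = hat_point n x"
    "pathfinish g = hat_point n y" "path_length g \<le> ennreal ((1 + 1 / real n) * \<bar>x - y\<bar>)"
    using hat_path[OF assms] .
  then show ?thesis using path_length_dist_le[of g hat_space "(1 + 1 / real n) * \<bar>x - y\<bar>"] by simp
qed

text \<open>The constant no longer depends on the hat; completeness and boundedness need this
  uniformity.\<close>

lemma hat_dist_same_hat_le2: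
  assumes "n \<ge> 1" "x \<in> {0..2}" "y \<in> {0..2}"
  shows "hat_dist (hat_point n x) (hat_point n y) \<le> 2 * \<bar>x - y\<bar>"
proof -
  have "hat_dist (hat_point n x) (hat_point n y) \<le> (1 + 1 / real n) * \<bar>x - y\<bar>"
    by (rule hat_dist_same_hat[OF assms])
  also have "\<dots> \<le> 2 * \<bar>x - y\<bar>"
    using assms(1) by (intro mult_right_mono) auto
  finally show ?thesis .
qed

text \<open>Off the two endpoints, the index of the hat is the continuous function
  \<open>(1 - \<bar>x - 1\<bar>) / y\<close>, so a path changing hats has to pass through an endpoint.\<close>

lemma hat_dist_different_hats:
  assumes n: "n \<ge> 1" and m: "m \<ge> 1" and x: "0 < x" "x < 2" and y: "0 < y" "y < 2" and "n \<noteq> m"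
  shows "min x (2 - x) \<le> hat_dist (hat_point n x) (hat_point m y)"
proof (rule path_length_dist_geI[OF rectifiably_connected_hat_space])
  show "hat_point n x \<in> hat_space" "hat_point m y \<in> hat_space"
    using assms by (auto intro!: hat_point_in_hat_space)
  fix g assume g: "path g" "path_image g \<subseteq> hat_space" "pathstart g = hat_point n x" "pathfinish g = hat_point m y"
  define k where "k p = (1 - \<bar>fst p - 1\<bar>) / snd p" for p :: "real \<times> real"
  have k_hat: "k (hat_point i z) = real i" if "i \<ge> 1" "0 < z" "z < 2" for i z
    using that by (auto simp: k_def hat_point_def abs_if)
  have "\<exists>t\<in>{0..1}. fst (g t) \<in> {0, 2}"
  proof (rule ccontr)
    assume avoid: "\<not> ?thesis"
    have gt: "\<exists>i z. i \<ge> 1 \<and> 0 < z \<and> z < 2 \<and> g t = hat_point i z" if "t \<in> {0..1}" for t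
    proof -
      have "g t \<in> hat_space" using that g(2) by (auto simp: path_image_def)
      then obtain i z where i: "i \<ge> 1" "0 \<le> z" "z \<le> 2" "g t = hat_point i z" by (rule hat_spaceE)
      moreover have "z \<noteq> 0" "z \<noteq> 2" using avoid that i(4) by force+
      ultimately show ?thesis by (intro exI[of _ i] exI[of _ z]) auto
    qed
    have "(\<lambda>t. k (g t)) constant_on {0..1}"
    proof (rule continuous_discrete_range_constant)
      have "snd (g t) \<noteq> 0" if "t \<in> {0..1}" for t
        using gt[OF that] by (auto simp: hat_point_def abs_if split: if_splits)
      then show "continuous_on {0..1} (\<lambda>t. k (g t))"
        unfolding k_def using g(1)[unfolded path_def] by (intro continuous_intros) auto
      fix t :: real assume t: "t \<in> {0..1}"
      \<comment> \<open>If \<open>g\<close> avoids the endpoints, \<open>k\<close> takes only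
        natural numbers as values along it. Distinct values are at least \<open>1\<close> apart, so
        continuity on the connected interval makes \<open>k\<close> constant.\<close>
      have "1 \<le> norm (k (g s) - k (g t))" if s: "s \<in> {0..1}" and "k (g s) \<noteq> k (g t)" for s
      proof -
        obtain i j where "k (g s) = real i" "k (g t) = real j"
          using gt[OF s] gt[OF t] k_hat by metis
        then show ?thesis using \<open>k (g s) \<noteq> k (g t)\<close> by (cases i j rule: linorder_cases) auto
      qed
      then show "\<exists>e>0. \<forall>s. s \<in> {0..1} \<and> k (g s) \<noteq> k (g t) \<longrightarrow> e \<le> norm (k (g s) - k (g t))"
        by (intro exI[of _ 1]) auto
    qed auto
    then have "k (g 0) = k (g 1)" by (auto simp: constant_on_def)
    then show False
      using g(3,4) assms by (simp add: pathstart_def pathfinish_def k_hat)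
  qed
  then obtain t where t: "t \<in> {0..1}" "fst (g t) \<in> {0, 2}" by blast
  have "min x (2 - x) \<le> dist (fst (g 0)) (fst (g t))"
    using t(2) g(3) x by (auto simp: pathstart_def dist_real_def)
  also have "\<dots> \<le> dist (g 0) (g t)" by (rule dist_fst_le)
  finally have "ennreal (min x (2 - x)) \<le> ennreal (dist (g 0) (g t))" by (rule ennreal_leI)
  also have "\<dots> \<le> path_length g" by (rule dist_start_le_path_length[OF t(1)])
  finally show "ennreal (min x (2 - x)) \<le> path_length g" .
qed

section \<open>Completeness, boundedness and the failure of total convexity\<close>

lemma mcomplete_hat_space: "Metric_space.mcomplete hat_space hat_dist"
proof -
  interpret H: Metric_space hat_space hat_dist
    by (rule Metric_space_path_length_dist[OF rectifiably_connected_hat_space])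
  show ?thesis
    unfolding H.mcomplete_def
  proof (intro allI impI)
    fix \<sigma> assume \<sigma>: "H.MCauchy \<sigma>"
    have "\<forall>k. \<exists>n x. n \<ge> 1 \<and> x \<in> {0..2} \<and> \<sigma> k = hat_point n x"
    proof
      fix k
      have "\<sigma> k \<in> hat_space" using \<sigma> by (auto simp: H.MCauchy_def)
      then show "\<exists>n x. n \<ge> 1 \<and> x \<in> {0..2} \<and> \<sigma> k = hat_point n x" by (auto simp: hat_space_eq)
    qed
    then obtain \<nu> \<xi> where \<sigma>_eq: "\<And>k. \<nu> k \<ge> 1" "\<And>k. \<xi> k \<in> {0..2}" "\<And>k. \<sigma> k = hat_point (\<nu> k) (\<xi> k)"
      by metis
    have \<xi>_le: "\<bar>\<xi> k - \<xi> l\<bar> \<le> hat_dist (\<sigma> k) (\<sigma> l)" for k l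
    proof -
      have "\<bar>\<xi> k - \<xi> l\<bar> \<le> dist (\<sigma> k) (\<sigma> l)"
        using dist_fst_le[of "\<sigma> k" "\<sigma> l"] by (simp add: \<sigma>_eq(3) dist_real_def)
      also have "\<dots> \<le> hat_dist (\<sigma> k) (\<sigma> l)"
        using \<sigma> by (intro dist_le_path_length_dist[OF rectifiably_connected_hat_space]) (auto simp: H.MCauchy_def)
      finally show ?thesis .
    qed
    have C: "\<exists>K. \<forall>k l. K \<le> k \<longrightarrow> K \<le> l \<longrightarrow> hat_dist (\<sigma> k) (\<sigma> l) < e" if "e > 0" for e
      using \<sigma> that by (simp add: H.MCauchy_def)
    have "Cauchy \<xi>"
    proof (rule metric_CauchyI)
      fix e :: real assume "e > 0"
      then obtain K where "\<forall>k l. K \<le> k \<longrightarrow> K \<le> l \<longrightarrow> hat_dist (\<sigma> k) (\<sigma> l) < e"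
        using C by blast
      then show "\<exists>K. \<forall>k\<ge>K. \<forall>l\<ge>K. dist (\<xi> k) (\<xi> l) < e"
        unfolding dist_real_def by (intro exI[of _ K] allI impI) (blast intro: \<xi>_le order.strict_trans1)
    qed
    then obtain a where a: "\<xi> \<longlonglongrightarrow> a" using Cauchy_convergent_iff convergent_def by blast
    have "a \<in> {0..2}" by (rule closed_sequentially[OF _ _ a]) (use \<sigma>_eq(2) in auto)
    \<comment> \<open>Comparing the points above \<open>a\<close> instead of the indices treats both
      cases alike: if \<open>a\<close> is an endpoint, \<open>\<nu>\<close> may never settle, but
      all hats share that point.\<close>
    obtain n where n: "n \<ge> 1" "\<forall>\<^sub>F k in sequentially. hat_point (\<nu> k) a = hat_point n a"
    proof (cases "a = 0 \<or> a = 2")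
      case True
      then show ?thesis by (intro that[of 1]) (auto simp: hat_point_0 hat_point_2)
    next
      case False
      \<comment> \<open>Half the distance from \<open>a\<close> to the nearer of \<open>0\<close>
        and \<open>2\<close>. A tail of \<open>\<xi>\<close> stays more than \<open>\<delta>\<close>
        away from both, while its points \<open>\<sigma> k\<close> are less than
        \<open>\<delta>\<close> apart, so no change of hat is possible.\<close>
      define \<delta> where "\<delta> = min a (2 - a) / 2"
      have \<delta>: "\<delta> > 0" "\<delta> < a" "a < 2 - \<delta>"
        using False \<open>a \<in> {0..2}\<close> by (auto simp: \<delta>_def min_def field_simps)
      obtain K1 where K1: "\<And>k l. \<lbrakk>k \<ge> K1; l \<ge> K1\<rbrakk> \<Longrightarrow> hat_dist (\<sigma> k) (\<sigma> l) < \<delta>"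
        using C[OF \<delta>(1)] by blast
      have "\<forall>\<^sub>F k in sequentially. \<delta> < \<xi> k \<and> \<xi> k < 2 - \<delta>"
        using order_tendstoD[OF a] \<delta> by (auto intro: eventually_conj)
      then obtain K2 where K2: "\<And>k. k \<ge> K2 \<Longrightarrow> \<delta> < \<xi> k \<and> \<xi> k < 2 - \<delta>"
        by (auto simp: eventually_sequentially)
      define K where "K = max K1 K2"
      have "\<nu> k = \<nu> K" if "k \<ge> K" for k
      proof (rule ccontr)
        assume ne: "\<nu> k \<noteq> \<nu> K"
        have "min (\<xi> k) (2 - \<xi> k) \<le> hat_dist (\<sigma> k) (\<sigma> K)"
          unfolding \<sigma>_eq(3) using K2[of k] K2[of K] that ne \<sigma>_eq(1) \<delta>(1)
          by (intro hat_dist_different_hats) (auto simp: K_def)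
        moreover have "hat_dist (\<sigma> k) (\<sigma> K) < \<delta>" using K1[of k K] that by (simp add: K_def)
        ultimately show False using K2[of k] that by (auto simp: K_def)
      qed
      then have "\<forall>k\<ge>K. hat_point (\<nu> k) a = hat_point (\<nu> K) a" by metis
      then show ?thesis
        using that[OF \<sigma>_eq(1)] unfolding eventually_sequentially by blast
    qed
    have "\<forall>\<^sub>F k in sequentially. \<sigma> k \<in> hat_space \<and> hat_dist (\<sigma> k) (hat_point n a) < e" if "e > 0" for e
    proof -
      have "\<forall>\<^sub>F k in sequentially. \<bar>\<xi> k - a\<bar> < e / 2"
        using tendstoD[OF a, of "e / 2"] that by (simp add: dist_real_def)
      with n(2) show ?thesis
      proof eventually_elim
        case (elim k)
        \<comment> \<open>The limit is rewritten as a point on the hat of \<open>\<sigma> k\<close>,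
          so the estimate within one hat applies even if \<open>\<nu> k\<close> differs from
          \<open>n\<close>.\<close>
        have "hat_dist (\<sigma> k) (hat_point n a) \<le> 2 * \<bar>\<xi> k - a\<bar>"
          unfolding \<sigma>_eq(3) elim(1)[symmetric]
          using \<sigma>_eq(1,2) \<open>a \<in> {0..2}\<close> by (intro hat_dist_same_hat_le2)
        then show ?case using elim(2) \<sigma> by (auto simp: H.MCauchy_def)
      qed
    qed
    moreover have "hat_point n a \<in> hat_space"
      using n(1) \<open>a \<in> {0..2}\<close> by (auto intro: hat_point_in_hat_space)
    ultimately show "\<exists>x. limitin H.mtopology \<sigma> x sequentially"
      unfolding H.limitin_metric by blast
  qed
qed

lemma mbounded_hat_space: "Metric_space.mbounded hat_space hat_dist hat_space"
proof -
  interpret H: Metric_space hat_space hat_dist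
    by (rule Metric_space_path_length_dist[OF rectifiably_connected_hat_space])
  \<comment> \<open>The radius is the uniform factor \<open>2\<close> times the width
    \<open>2\<close> of the hats.\<close>
  have "hat_space \<subseteq> H.mcball (0, 0) 4"
  proof
    fix p assume "p \<in> hat_space"
    then obtain n x where p: "n \<ge> 1" "0 \<le> x" "x \<le> 2" "p = hat_point n x" by (rule hat_spaceE)
    then show "p \<in> H.mcball (0, 0) 4"
      using hat_dist_same_hat_le2[of n 0 x] hat_point_in_hat_space[of n 0] \<open>p \<in> hat_space\<close>
      by (auto simp: hat_point_0)
  qed
  then show ?thesis unfolding H.mbounded_def by blast
qed

lemma hat_dist_endpoints: "hat_dist (0, 0) (2, 0) = 2"
proof (rule antisym)
  \<comment> \<open>The bound from each single hat exceeds \<open>2\<close>, so a limit is taken. It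
    is claimed only eventually because index \<open>0\<close> belongs to no hat.\<close>
  have "\<forall>\<^sub>F n in sequentially. hat_dist (0, 0) (2, 0) \<le> (1 + 1 / real n) * 2"
    using eventually_ge_at_top[of 1]
    by eventually_elim (use hat_dist_same_hat[of _ 0 2] in \<open>simp add: hat_point_0 hat_point_2\<close>)
  moreover have "(\<lambda>n. (1 + 1 / real n) * 2) \<longlonglongrightarrow> (1 + 0) * 2"
    by (intro tendsto_intros lim_1_over_n)
  ultimately show "hat_dist (0, 0) (2, 0) \<le> 2"
    by (intro tendsto_lowerbound[of "\<lambda>n. (1 + 1 / real n) * 2" 2 sequentially]) auto
  have "dist (0 :: real, 0 :: real) (2, 0) \<le> hat_dist (0, 0) (2, 0)"
    using hat_point_in_hat_space[of 1 0] hat_point_in_hat_space[of 1 2]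
    by (intro dist_le_path_length_dist[OF rectifiably_connected_hat_space])
      (auto simp: hat_point_0 hat_point_2)
  then show "2 \<le> hat_dist (0, 0) (2, 0)" by (simp add: dist_Pair_Pair dist_real_def)
qed

lemma not_totally_convex_hat_space: "\<not> Metric_space.totally_convex hat_space hat_dist"
proof
  have ends: "(0, 0) \<in> hat_space" "(2, 0) \<in> hat_space"
    using hat_point_in_hat_space[of 1 0] hat_point_in_hat_space[of 1 2]
    by (auto simp: hat_point_0 hat_point_2)
  assume "Metric_space.totally_convex hat_space hat_dist"
  then have "\<exists>z\<in>hat_space. hat_dist (0, 0) z = 1 \<and> hat_dist (2, 0) z = 1"
    unfolding Metric_space.totally_convex_def[OF Metric_space_path_length_dist[OF rectifiably_connected_hat_space]]
    using ends hat_dist_endpoints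
    by (elim ballE[of _ _ "(0, 0)"] ballE[of _ _ "(2, 0)"] allE[of _ 1]) auto
  then obtain z where z: "z \<in> hat_space" "hat_dist (0, 0) z = 1" "hat_dist (2, 0) z = 1" by blast
  then obtain n x where n: "n \<ge> 1" "0 \<le> x" "x \<le> 2" "z = hat_point n x" by (auto elim: hat_spaceE)
  define y where "y = (1 - \<bar>x - 1\<bar>) / real n"
  have "dist (0, 0) z \<le> 1" "dist (2, 0) z \<le> 1"
    using dist_le_path_length_dist[OF rectifiably_connected_hat_space ends(1) z(1)]
      dist_le_path_length_dist[OF rectifiably_connected_hat_space ends(2) z(1)] z by auto
  then have "x\<^sup>2 + y\<^sup>2 \<le> 1" "(2 - x)\<^sup>2 + y\<^sup>2 \<le> 1"
    by (simp_all add: n hat_point_def dist_Pair_Pair dist_real_def y_def power_divide)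
  \<comment> \<open>Half the sum of the two inequalities: the closed unit discs around the endpoints
    touch only in \<open>(1, 0)\<close>.\<close>
  then have "(x - 1)\<^sup>2 + y\<^sup>2 \<le> 0" by (simp add: power2_eq_square algebra_simps)
  then have "x = 1" "y = 0" by (simp_all add: sum_power2_le_zero_iff)
  \<comment> \<open>At abscissa \<open>1\<close> the hat has height \<open>1 / real n\<close>, which
    is not \<open>0\<close>.\<close>
  then show False using n(1) by (simp add: y_def)
qed

theorem theorem2p1:
  shows "Metric_space hat_space hat_dist
    \<and> Metric_space.mbounded hat_space hat_dist hat_space
    \<and> Metric_space.mcomplete hat_space hat_dist
    \<and> Metric_space.almost_convex hat_space hat_dist
    \<and> \<not> Metric_space.totally_convex hat_space hat_dist"
  by (intro conjI Metric_space_path_length_dist almost_convex_path_length_dist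
      rectifiably_connected_hat_space mbounded_hat_space mcomplete_hat_space
      not_totally_convex_hat_space)

end
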